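(* Let $A\in\mathbb{R}\setminus\{0\}$, $\Sigma>0$, $\alpha>0$, $\gamma>0$ and $u^\dagger\in\mathbb{R}$. Let $\eta_1,\eta_2,\dots$ be i.i.d. $N(0,\gamma^2)$ random variables and $y_n=Au^\dagger+\eta_n$. Let $u_0\in\mathbb{R}$ be deterministic and let $(u_n)_{n\ge 1}$ be generated by the scalar 3DVAR iteration $$u_n=\mathcal{K}y_n+(1-\mathcal{K}A)u_{n-1},\qquad \mathcal{K}=\frac{A}{A^2+\alpha\Sigma^{-1}}.$$ Then for every $n\ge 1$, $$\mathbb{E}\left[|u_n-u^\dagger|^2\right]\ge \gamma^2\mathcal{K}^2.$$
   Context: This is the one-dimensional setting ($X=Y=\mathbb{R}$) of the linear inverse problem $y=Au^\dagger+\eta$ with i.i.d. observations $y_n$; all operators are real scalars. *)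

theory Defs
  imports "HOL-Probability.Probability"
begin

definition threedvar_gain :: "real \<Rightarrow> real \<Rightarrow> real \<Rightarrow> real" where
  "threedvar_gain A \<Sigma> \<alpha> = A / (A\<^sup>2 + \<alpha> * inverse \<Sigma>)"

end

theory Submission
  imports Defs
begin

text \<open>
  In terms of the error \<open>e\<^sub>n = u\<^sub>n - u\<^sup>\<dagger>\<close>, the iteration
  reads \<open>e\<^sub>n = K \<eta>\<^sub>n + c e\<^sub>n\<^sub>-\<^sub>1\<close> with \<open>c = 1 - K A\<close>: the
  part of the data that comes from the truth cancels.  The previous error is an affine
  combination of the earlier noises, so it is orthogonal to \<open>\<eta>\<^sub>n\<close> in
  \<open>L\<^sup>2\<close> (\<open>affine_recursion_orthogonal\<close>).  The Pythagorean identity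
  \<open>E e\<^sub>n\<^sup>2 = K\<^sup>2 \<gamma>\<^sup>2 + c\<^sup>2 E e\<^sub>n\<^sub>-\<^sub>1\<^sup>2\<close>
  follows, and dropping its last term leaves the bound: each step injects the fresh noise of
  the current observation with gain \<open>K\<close>, and nothing in the past can compensate it.
\<close>

text \<open>
  The error \<open>e m\<close> is affine in the noises up to index \<open>m\<close>, so a
  centred noise of larger index, orthogonal to each of these, is orthogonal to
  \<open>e m\<close>.  Multiplying the recursion by \<open>\<xi> n\<close> turns this into an induction
  on \<open>m\<close> with \<open>n > m\<close> arbitrary, and no closed form of \<open>e m\<close> is
  needed.  Square integrability is carried along because the Bochner integral of a
  non-integrable function is \<open>0\<close>, which would spoil a lower bound.
\<close>

lemma (in prob_space) affine_recursion_orthogonal: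
  fixes e \<xi> :: "nat \<Rightarrow> 'a \<Rightarrow> real" and c K \<sigma> e0 :: real
  assumes init: "\<And>\<omega>. \<omega> \<in> space M \<Longrightarrow> e 0 \<omega> = e0"
    and step: "\<And>n \<omega>. \<omega> \<in> space M \<Longrightarrow> e (Suc n) \<omega> = K * \<xi> (Suc n) \<omega> + c * e n \<omega>"
    and mean: "\<And>n. n \<ge> 1 \<Longrightarrow> has_bochner_integral M (\<xi> n) 0"
    and var: "\<And>n. n \<ge> 1 \<Longrightarrow> has_bochner_integral M (\<lambda>\<omega>. (\<xi> n \<omega>)\<^sup>2) (\<sigma>\<^sup>2)"
    and orth: "\<And>i j. 1 \<le> i \<Longrightarrow> i < j \<Longrightarrow> has_bochner_integral M (\<lambda>\<omega>. \<xi> j \<omega> * \<xi> i \<omega>) 0"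
  shows "integrable M (\<lambda>\<omega>. (e m \<omega>)\<^sup>2)"
    and "n > m \<Longrightarrow> has_bochner_integral M (\<lambda>\<omega>. \<xi> n \<omega> * e m \<omega>) 0"
proof (induction m arbitrary: n)
  case 0
  {
    case 1
    show ?case
      using init by (simp cong: Bochner_Integration.integrable_cong)
  next
    case 2
    then have "has_bochner_integral M (\<lambda>\<omega>. \<xi> n \<omega> * e0) (0 * e0)"
      by (intro has_bochner_integral_mult_left mean) auto
    then show ?case
      using init by (simp cong: has_bochner_integral_cong)
  }
next
  case (Suc m)
  {
    case 1
    have "integrable M (\<lambda>\<omega>. K\<^sup>2 * (\<xi> (Suc m) \<omega>)\<^sup>2 + c\<^sup>2 * (e m \<omega>)\<^sup>2 + 2 * K * c * (\<xi> (Suc m) \<omega> * e m \<omega>))"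
      using Suc.IH(1) Suc.IH(2)[of "Suc m"] var[of "Suc m"]
      by (auto simp: has_bochner_integral_iff)
    moreover have "(e (Suc m) \<omega>)\<^sup>2
        = K\<^sup>2 * (\<xi> (Suc m) \<omega>)\<^sup>2 + c\<^sup>2 * (e m \<omega>)\<^sup>2 + 2 * K * c * (\<xi> (Suc m) \<omega> * e m \<omega>)"
      if "\<omega> \<in> space M" for \<omega>
      using step[OF that] by (simp add: power2_eq_square algebra_simps)
    ultimately show ?case
      by (simp cong: Bochner_Integration.integrable_cong)
  next
    case 2
    then have "has_bochner_integral M
        (\<lambda>\<omega>. K * (\<xi> n \<omega> * \<xi> (Suc m) \<omega>) + c * (\<xi> n \<omega> * e m \<omega>)) (K * 0 + c * 0)"
      by (intro has_bochner_integral_add has_bochner_integral_mult_right orth Suc.IH(2)) auto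
    moreover have "\<xi> n \<omega> * e (Suc m) \<omega>
        = K * (\<xi> n \<omega> * \<xi> (Suc m) \<omega>) + c * (\<xi> n \<omega> * e m \<omega>)" if "\<omega> \<in> space M" for \<omega>
      using step[OF that] by (simp add: algebra_simps)
    ultimately show ?case
      by (simp cong: has_bochner_integral_cong)
  }
qed

text \<open>
  The Pythagorean identity for one step: the cross term vanishes by orthogonality.
\<close>

lemma (in prob_space) affine_recursion_second_moment:
  fixes e \<xi> :: "nat \<Rightarrow> 'a \<Rightarrow> real" and c K \<sigma> e0 :: real
  assumes init: "\<And>\<omega>. \<omega> \<in> space M \<Longrightarrow> e 0 \<omega> = e0"
    and step: "\<And>n \<omega>. \<omega> \<in> space M \<Longrightarrow> e (Suc n) \<omega> = K * \<xi> (Suc n) \<omega> + c * e n \<omega>"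
    and mean: "\<And>n. n \<ge> 1 \<Longrightarrow> has_bochner_integral M (\<xi> n) 0"
    and var: "\<And>n. n \<ge> 1 \<Longrightarrow> has_bochner_integral M (\<lambda>\<omega>. (\<xi> n \<omega>)\<^sup>2) (\<sigma>\<^sup>2)"
    and orth: "\<And>i j. 1 \<le> i \<Longrightarrow> i < j \<Longrightarrow> has_bochner_integral M (\<lambda>\<omega>. \<xi> j \<omega> * \<xi> i \<omega>) 0"
  shows "expectation (\<lambda>\<omega>. (e (Suc m) \<omega>)\<^sup>2) = K\<^sup>2 * \<sigma>\<^sup>2 + c\<^sup>2 * expectation (\<lambda>\<omega>. (e m \<omega>)\<^sup>2)"
proof -
  note past = affine_recursion_orthogonal[of e e0 K \<xi> c \<sigma>, OF init step mean var orth]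
  have "has_bochner_integral M
      (\<lambda>\<omega>. K\<^sup>2 * (\<xi> (Suc m) \<omega>)\<^sup>2 + c\<^sup>2 * (e m \<omega>)\<^sup>2 + 2 * K * c * (\<xi> (Suc m) \<omega> * e m \<omega>))
      (K\<^sup>2 * \<sigma>\<^sup>2 + c\<^sup>2 * expectation (\<lambda>\<omega>. (e m \<omega>)\<^sup>2) + 2 * K * c * 0)"
    by (intro has_bochner_integral_add has_bochner_integral_mult_right var past(2)
        has_bochner_integral_integrable past(1)) auto
  moreover have "(e (Suc m) \<omega>)\<^sup>2
      = K\<^sup>2 * (\<xi> (Suc m) \<omega>)\<^sup>2 + c\<^sup>2 * (e m \<omega>)\<^sup>2 + 2 * K * c * (\<xi> (Suc m) \<omega> * e m \<omega>)"
    if "\<omega> \<in> space M" for \<omega>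
    using step[OF that] by (simp add: power2_eq_square algebra_simps)
  ultimately show ?thesis
    by (simp add: has_bochner_integral_iff cong: Bochner_Integration.integral_cong)
qed

lemma (in prob_space) centred_normal_moments:
  fixes X :: "'a \<Rightarrow> real"
  assumes "distributed M lborel X (normal_density 0 \<sigma>)" and "\<sigma> > 0"
  shows "has_bochner_integral M X 0"
    and "has_bochner_integral M (\<lambda>\<omega>. (X \<omega>)\<^sup>2) (\<sigma>\<^sup>2)"
proof -
  have "integrable M (\<lambda>\<omega>. X \<omega> ^ k)" for k
    using integrable_normal_moment[OF assms(2), of 0 k]
      distributed_integrable[OF assms(1), of "\<lambda>x. x ^ k"] by simp
  from this[of 1] this[of 2] show "has_bochner_integral M X 0"
      "has_bochner_integral M (\<lambda>\<omega>. (X \<omega>)\<^sup>2) (\<sigma>\<^sup>2)"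
    using normal_distributed_expectation[OF assms(2,1)]
      normal_distributed_variance[OF assms(2,1)]
    by (simp_all add: has_bochner_integral_iff)
qed

theorem theorem1p5:
  fixes M :: "'a measure"
    and A \<Sigma> \<alpha> \<gamma> u_dag u0 K :: real
    and \<eta> y u :: "nat \<Rightarrow> 'a \<Rightarrow> real"
  assumes "prob_space M"
    and "A \<noteq> 0" and "\<Sigma> > 0" and "\<alpha> > 0" and "\<gamma> > 0"
    and "prob_space.indep_vars M (\<lambda>_. borel) \<eta> {1..}"
    and "\<And>n. n \<ge> 1 \<Longrightarrow> distributed M lborel (\<eta> n) (normal_density 0 \<gamma>)"
    and "\<And>n \<omega>. n \<ge> 1 \<Longrightarrow> \<omega> \<in> space M \<Longrightarrow> y n \<omega> = A * u_dag + \<eta> n \<omega>"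
    and "K = threedvar_gain A \<Sigma> \<alpha>"
    and "\<And>\<omega>. \<omega> \<in> space M \<Longrightarrow> u 0 \<omega> = u0"
    and "\<And>n \<omega>. n \<ge> 1 \<Longrightarrow> \<omega> \<in> space M \<Longrightarrow> u n \<omega> = K * y n \<omega> + (1 - K * A) * u (n - 1) \<omega>"
  shows "\<forall>n\<ge>1. prob_space.expectation M (\<lambda>\<omega>. \<bar>u n \<omega> - u_dag\<bar>\<^sup>2) \<ge> \<gamma>\<^sup>2 * K\<^sup>2"
proof (intro allI impI)
  interpret prob_space M by fact
  fix n :: nat assume "n \<ge> 1"
  then obtain m where n: "n = Suc m"
    by (cases n) auto
  define e where "e k \<omega> = u k \<omega> - u_dag" for k \<omega>
  have init: "e 0 \<omega> = u0 - u_dag" if "\<omega> \<in> space M" for \<omega>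
    using assms(10) that by (simp add: e_def)
  have step: "e (Suc k) \<omega> = K * \<eta> (Suc k) \<omega> + (1 - K * A) * e k \<omega>" if "\<omega> \<in> space M" for k \<omega>
    using assms(11)[of "Suc k" \<omega>] assms(8)[of "Suc k" \<omega>] that
    by (simp add: e_def algebra_simps)
  note moments = centred_normal_moments[OF assms(7) assms(5)]
  have orth: "has_bochner_integral M (\<lambda>\<omega>. \<eta> j \<omega> * \<eta> i \<omega>) 0" if "1 \<le> i" "i < j" for i j
  proof -
    have pair: "indep_vars (\<lambda>_. borel) \<eta> {i, j}"
      using that by (intro indep_vars_subset[OF assms(6)]) auto
    have int: "integrable M (\<eta> k)" if "k \<in> {i, j}" for k
      using moments(1)[of k] that \<open>1 \<le> i\<close> \<open>i < j\<close> by (auto simp: has_bochner_integral_iff)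
    show ?thesis
      using indep_vars_integrable[OF _ pair int] indep_vars_lebesgue_integral[OF _ pair int]
        moments(1)[of i] that
      by (simp add: has_bochner_integral_iff mult.commute)
  qed
  have "expectation (\<lambda>\<omega>. (e n \<omega>)\<^sup>2)
      = K\<^sup>2 * \<gamma>\<^sup>2 + (1 - K * A)\<^sup>2 * expectation (\<lambda>\<omega>. (e m \<omega>)\<^sup>2)"
    unfolding n
    by (rule affine_recursion_second_moment[OF init step moments orth])
  also have "\<dots> \<ge> \<gamma>\<^sup>2 * K\<^sup>2"
    by (simp add: mult.commute)
  finally show "expectation (\<lambda>\<omega>. \<bar>u n \<omega> - u_dag\<bar>\<^sup>2) \<ge> \<gamma>\<^sup>2 * K\<^sup>2"
    by (simp add: e_def)
qed

end
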